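(* Let $G$ be a connected graph of order at least $3$ that is $3$-colorable. Then $G$ has a distance-$2$ fall $3$-coloring; that is, there is a proper coloring of the vertices of $G$ with colors from $\{1,2,3\}$ such that for every vertex $v$ of $G$ and every color $i\in\{1,2,3\}$, there is a vertex of color $i$ at distance at most $2$ from $v$.
   Context: All graphs are finite and simple. A proper coloring assigns colors to vertices so that adjacent vertices receive different colors; a $3$-colorable graph is one admitting a proper coloring with at most $3$ colors. Distance is the usual shortest-path distance in $G$ (a vertex is at distance $0$ from itself). A proper coloring is called distance-$k$ fall if every vertex is within distance $k$ of at least one vertex of every color. *)

theory Defs
  imports "Graph_Theory.Graph_Theory"
begin

text \<open>
  A finite simple graph is a digraph satisfying the locale predicate \<open>graph\<close>: finite, loop-free,
  without parallel arcs, and symmetric. Each undirected edge is thus a pair of opposite arcs.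
\<close>

text \<open>Unit arc weights; the value is \<open>\<infinity>\<close> if \<open>v\<close> is not reachable from \<open>u\<close>.\<close>

definition graph_dist :: "('a, 'b) pre_digraph \<Rightarrow> 'a \<Rightarrow> 'a \<Rightarrow> ereal" where
  "graph_dist G u v = wf_digraph.\<mu> G (\<lambda>_. 1) u v"

definition proper_coloring :: "('a, 'b) pre_digraph \<Rightarrow> ('a \<Rightarrow> 'c) \<Rightarrow> bool" where
  "proper_coloring G c \<longleftrightarrow>
     (\<forall>u \<in> verts G. \<forall>v \<in> verts G. u \<rightarrow>\<^bsub>G\<^esub> v \<longrightarrow> c u \<noteq> c v)"

definition colorable :: "('a, 'b) pre_digraph \<Rightarrow> nat \<Rightarrow> bool" where
  "colorable G n \<longleftrightarrow>
     (\<exists>c :: 'a \<Rightarrow> nat. proper_coloring G c \<and> finite (c ` verts G) \<and> card (c ` verts G) \<le> n)"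

text \<open>
  \<open>C\<close> is the palette. Every color of \<open>C\<close> has to occur near every vertex, including the colors
  that \<open>c\<close> might not use.
\<close>

definition distance_fall_coloring ::
    "('a, 'b) pre_digraph \<Rightarrow> nat \<Rightarrow> 'c set \<Rightarrow> ('a \<Rightarrow> 'c) \<Rightarrow> bool" where
  "distance_fall_coloring G k C c \<longleftrightarrow>
     proper_coloring G c \<and> c ` verts G \<subseteq> C \<and>
     (\<forall>v \<in> verts G. \<forall>i \<in> C. \<exists>w \<in> verts G. c w = i \<and> graph_dist G v w \<le> ereal (real k))"

end

theory Submission
  imports Defs
begin

text \<open>
  Take a proper 3-coloring with the fewest bad vertices, a vertex being bad if it has no vertex of
  some color within distance 2. If \<open>v\<close> of color \<open>a\<close> is bad and misses color \<open>i\<close>, then its neighbors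
  all have the third color \<open>b\<close>, and the vertices at distance 2 all have color \<open>a\<close>. If there is a
  vertex at distance 2, recoloring \<open>v\<close> with \<open>i\<close> repairs \<open>v\<close> and spoils no other vertex.
  Otherwise the graph is a star with center \<open>v\<close>, and recoloring one of its at least two leaves
  repairs everything.
\<close>

text \<open>Spells out distance at most 2 by walks with zero, one or two arcs, so that witnesses can
  be found by case distinction. Membership of \<open>u\<close> in \<open>verts G\<close> matters for
  the case \<open>u = v\<close>, where the empty walk exists only at a vertex.\<close>

definition within_two :: "('a, 'b) pre_digraph \<Rightarrow> 'a \<Rightarrow> 'a \<Rightarrow> bool" where
  "within_two G u v \<longleftrightarrow>
     u \<in> verts G \<and> (u = v \<or> u \<rightarrow>\<^bsub>G\<^esub> v \<or> (\<exists>x. u \<rightarrow>\<^bsub>G\<^esub> x \<and> x \<rightarrow>\<^bsub>G\<^esub> v))"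

definition bad_verts :: "('a, 'b) pre_digraph \<Rightarrow> 'c set \<Rightarrow> ('a \<Rightarrow> 'c) \<Rightarrow> 'a set" where
  "bad_verts G C c = {v \<in> verts G. \<exists>i \<in> C. \<forall>w. within_two G v w \<longrightarrow> c w \<noteq> i}"

text \<open>With unit weights the cost of a walk is its number of arcs, and the minimal cost is at
  most that of the explicit walk with at most two arcs.\<close>

lemma (in wf_digraph) graph_dist_le_two:
  assumes "within_two G u v"
  shows "graph_dist G u v \<le> ereal (real 2)"
proof -
  have "\<exists>p. awalk u p v \<and> length p \<le> 2"
  proof -
    consider "u \<in> verts G" "u = v" | "u \<rightarrow>\<^bsub>G\<^esub> v" | x where "u \<rightarrow>\<^bsub>G\<^esub> x" "x \<rightarrow>\<^bsub>G\<^esub> v"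
      using assms unfolding within_two_def by blast
    then show ?thesis
    proof cases
      case 1
      then have "awalk u [] v" by (simp add: awalk_Nil_iff)
      then show ?thesis by force
    next
      case 2
      then obtain e where "e \<in> arcs G" "tail G e = u" "head G e = v" by blast
      then have "awalk u [e] v" by (auto simp: awalk_simps)
      then show ?thesis by force
    next
      case 3
      then obtain e f where "e \<in> arcs G" "tail G e = u" "head G e = x"
        "f \<in> arcs G" "tail G f = x" "head G f = v" by blast
      then have "awalk u [e, f] v" by (auto simp: awalk_simps)
      then show ?thesis by force
    qed
  qed
  then obtain p where p: "awalk u p v" "length p \<le> 2" by blast
  have "awalk_cost (\<lambda>_. 1) p = length p"
    by (simp add: awalk_cost_def sum_list_triv)
  then show ?thesis
    using min_cost_le_walk_cost[OF p(1), of "\<lambda>_. 1"] p(2)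
    unfolding graph_dist_def by (auto elim: order_trans)
qed

lemma (in wf_digraph) distance_fall_coloringI:
  assumes "proper_coloring G c" "c ` verts G \<subseteq> C" "bad_verts G C c = {}"
  shows "distance_fall_coloring G 2 C c"
proof -
  have "\<exists>w \<in> verts G. c w = i \<and> graph_dist G v w \<le> ereal (real 2)"
    if vi: "v \<in> verts G" "i \<in> C" for v i
  proof -
    obtain w where w: "within_two G v w" "c w = i"
      using assms(3) vi unfolding bad_verts_def by blast
    then have "w \<in> verts G"
      unfolding within_two_def by (auto dest: adj_in_verts)
    with w show ?thesis using graph_dist_le_two by blast
  qed
  with assms(1,2) show ?thesis unfolding distance_fall_coloring_def by blast
qed

lemma proper_coloring_inj_comp:
  assumes "proper_coloring G c" "inj_on f (c ` verts G)"
  shows "proper_coloring G (f \<circ> c)"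
  using assms unfolding proper_coloring_def inj_on_def by auto

text \<open>The colors in use inject into the palette, and renaming colors injectively keeps a
  coloring proper.\<close>

lemma colorable_palette:
  assumes "colorable G n" "finite C" "card C = n"
  shows "\<exists>c. proper_coloring G c \<and> c ` verts G \<subseteq> C"
proof -
  obtain c :: "_ \<Rightarrow> nat" where c: "proper_coloring G c" "finite (c ` verts G)"
    "card (c ` verts G) \<le> card C"
    using assms unfolding colorable_def by blast
  then obtain f where "f ` c ` verts G \<subseteq> C" "inj_on f (c ` verts G)"
    using card_le_inj[OF c(2) assms(2)] by blast
  then show ?thesis
    using proper_coloring_inj_comp[OF c(1)] by (intro exI[of _ "f \<circ> c"]) (auto simp: image_comp)
qed

lemma (in graph) connected_closed_eq_verts:
  assumes "Digraph_Component.connected G" "v \<in> S" "S \<subseteq> verts G"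
    and closed: "\<And>x y. x \<in> S \<Longrightarrow> x \<rightarrow>\<^bsub>G\<^esub> y \<Longrightarrow> y \<in> S"
  shows "S = verts G"
proof (intro equalityI subsetI)
  fix w assume "w \<in> verts G"
  then have "v \<rightarrow>\<^sup>*\<^bsub>mk_symmetric G\<^esub> w"
    using assms(1-3) unfolding Digraph_Component.connected_def strongly_connected_def by auto
  \<comment> \<open>Connectedness is defined through the symmetric closure, which adds no
    reachability here because the arcs are already symmetric.\<close>
  then have "v \<rightarrow>\<^sup>* w" by (simp add: reachable_mk_symmetric_eq[OF sym_arcs])
  then show "w \<in> S"
    by (induct rule: reachable_induct) (use \<open>v \<in> S\<close> closed in auto)
qed (use assms(3) in auto)

text \<open>The descent step. Since \<open>v\<close> misses \<open>i\<close>, its neighbors have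
  color \<open>b\<close> and the ends of two-arc walks from \<open>v\<close> have color
  \<open>a\<close>. Giving \<open>v\<close> the color \<open>i\<close> creates no conflict and can
  only deprive other vertices of a witness for \<open>a\<close>. The walk to \<open>x\<close>
  ensures that \<open>v\<close> itself still sees \<open>a\<close>.\<close>

lemma (in graph) bad_verts_recolor:
  assumes c: "proper_coloring G c" "c ` verts G \<subseteq> {a, b, i}"
    and dist: "a \<noteq> b" "a \<noteq> i" "b \<noteq> i"
    and v: "v \<in> verts G" "c v = a"
    and miss: "\<And>w. within_two G v w \<Longrightarrow> c w \<noteq> i"
    and walk: "v \<rightarrow>\<^bsub>G\<^esub> u" "u \<rightarrow>\<^bsub>G\<^esub> x" "x \<noteq> v"
  shows "proper_coloring G (c(v := i))"
    and "bad_verts G {a, b, i} (c(v := i)) \<subset> bad_verts G {a, b, i} c"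
proof -
  have neighbor: "c y = b" if "v \<rightarrow>\<^bsub>G\<^esub> y" for y
  proof -
    have "y \<in> verts G" using that by (auto dest: adj_in_verts)
    moreover have "c y \<noteq> a" using c(1) that v \<open>y \<in> verts G\<close> unfolding proper_coloring_def by blast
    moreover have "c y \<noteq> i" using that v miss unfolding within_two_def by blast
    ultimately show ?thesis using c(2) by auto
  qed
  have second: "c z = a" if "v \<rightarrow>\<^bsub>G\<^esub> y" "y \<rightarrow>\<^bsub>G\<^esub> z" for y z
  proof -
    have "y \<in> verts G" "z \<in> verts G" using that by (auto dest: adj_in_verts)
    moreover have "c z \<noteq> b"
      using c(1) that(2) neighbor[OF that(1)] calculation unfolding proper_coloring_def by fastforce
    moreover have "c z \<noteq> i" using that v miss unfolding within_two_def by blast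
    ultimately show ?thesis using c(2) by auto
  qed
  have irrefl: "\<not> v \<rightarrow>\<^bsub>G\<^esub> v" using adj_not_same by blast
  have sym: "p \<rightarrow>\<^bsub>G\<^esub> q \<Longrightarrow> q \<rightarrow>\<^bsub>G\<^esub> p" for p q
    using sym_arcs arcs_ends_symmetric by metis
  let ?c = "c(v := i)"
  show "proper_coloring G ?c"
    unfolding proper_coloring_def
  proof (intro ballI impI)
    fix x y assume xy: "x \<in> verts G" "y \<in> verts G" "x \<rightarrow>\<^bsub>G\<^esub> y"
    then have "c x \<noteq> c y" using c(1) unfolding proper_coloring_def by blast
    moreover have "c y = b" if "x = v" using neighbor xy(3) that by blast
    moreover have "c x = b" if "y = v" using neighbor sym[OF xy(3)] that by blast
    ultimately show "?c x \<noteq> ?c y" using xy(3) irrefl dist by auto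
  qed
  \<comment> \<open>The witnesses are \<open>v\<close> for \<open>i\<close>, \<open>u\<close> for
    \<open>b\<close> and \<open>x\<close> for \<open>a\<close>; the last keeps its color because
    \<open>x\<close> differs from \<open>v\<close>.\<close>
  have v_good: "\<exists>w. within_two G v w \<and> ?c w = j" if "j \<in> {a, b, i}" for j
  proof -
    have "within_two G v v" "within_two G v u" "within_two G v x"
      using v walk unfolding within_two_def by blast+
    moreover have "?c v = i" "?c u = b" "?c x = a"
      using neighbor second walk irrefl by auto
    ultimately show ?thesis using that by blast
  qed
  have "\<exists>z. within_two G w z \<and> ?c z = j"
    if w: "w \<in> verts G" "w \<notin> bad_verts G {a, b, i} c" and j: "j \<in> {a, b, i}" for w j
  proof -
    have good: "\<exists>z. within_two G w z \<and> c z = k" if "k \<in> {a, b, i}" for k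
      using w that unfolding bad_verts_def by blast
    then obtain z where z: "within_two G w z" "c z = j" using j by blast
    show ?thesis
    \<comment> \<open>A witness other than \<open>v\<close> keeps its color. If the witness is
      \<open>v\<close>, the color at stake is \<open>a\<close>, and a replacement must be found
      according to how \<open>w\<close> reaches \<open>v\<close>.\<close>
    proof (cases "z = v")
      case False
      with z show ?thesis by (metis fun_upd_apply)
    next
      case True
      then have "j = a" using z v by simp
      from z True consider "w = v" | "w \<rightarrow>\<^bsub>G\<^esub> v" | y where "w \<noteq> v" "w \<rightarrow>\<^bsub>G\<^esub> y" "y \<rightarrow>\<^bsub>G\<^esub> v"
        unfolding within_two_def by blast
      then show ?thesis
      proof cases
        case 1
        then show ?thesis using v_good j by blast
      next
        case 2
        have "\<exists>y. w \<rightarrow>\<^bsub>G\<^esub> y \<and> y \<noteq> v"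
        proof (rule ccontr)
          \<comment> \<open>A leaf attached to \<open>v\<close> sees no more than \<open>v\<close> does, so it misses \<open>i\<close> as well.\<close>
          assume leaf: "\<nexists>y. w \<rightarrow>\<^bsub>G\<^esub> y \<and> y \<noteq> v"
          obtain s where "within_two G w s" "c s = i" using good by blast
          moreover have "within_two G v s"
            using \<open>within_two G w s\<close> leaf v sym[OF 2] unfolding within_two_def by blast
          ultimately show False using miss by blast
        qed
        then obtain y where y: "w \<rightarrow>\<^bsub>G\<^esub> y" "y \<noteq> v" by blast
        then have "within_two G w y" "?c y = a"
          using second[OF sym[OF 2] y(1)] w unfolding within_two_def by auto
        then show ?thesis using \<open>j = a\<close> by blast
      next
        \<comment> \<open>Reversing the walk shows that \<open>w\<close> ends a two-arc walk from
          \<open>v\<close>, so \<open>w\<close> has color \<open>a\<close> and is its own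
          witness.\<close>
        case 3
        then have "within_two G w w" "?c w = a"
          using second sym w unfolding within_two_def by auto
        then show ?thesis using \<open>j = a\<close> by blast
      qed
    qed
  qed
  then have "bad_verts G {a, b, i} ?c \<subseteq> bad_verts G {a, b, i} c"
    unfolding bad_verts_def[of _ _ ?c] by blast
  moreover have "v \<in> bad_verts G {a, b, i} c"
    using v miss unfolding bad_verts_def by blast
  moreover have "v \<notin> bad_verts G {a, b, i} ?c"
    using v_good unfolding bad_verts_def by blast
  ultimately show "bad_verts G {a, b, i} ?c \<subset> bad_verts G {a, b, i} c" by blast
qed

text \<open>Any two vertices of a star are joined through the center within two arcs, so a proper
  coloring only has to use all three colors: one for the center, one for a single leaf and one for
  the other leaves. Order at least 3 provides two leaves.\<close>

lemma (in graph) star_distance_fall_coloring: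
  assumes star: "verts G = insert v {u. v \<rightarrow>\<^bsub>G\<^esub> u}" "\<And>u x. v \<rightarrow>\<^bsub>G\<^esub> u \<Longrightarrow> u \<rightarrow>\<^bsub>G\<^esub> x \<Longrightarrow> x = v"
    and card: "card (verts G) \<ge> 3"
    and dist: "a \<noteq> b" "a \<noteq> i" "b \<noteq> i"
  shows "\<exists>c. distance_fall_coloring G 2 {a, b, i} c"
proof -
  have irrefl: "\<not> v \<rightarrow>\<^bsub>G\<^esub> v" using adj_not_same by blast
  have sym: "p \<rightarrow>\<^bsub>G\<^esub> q \<Longrightarrow> q \<rightarrow>\<^bsub>G\<^esub> p" for p q
    using sym_arcs arcs_ends_symmetric by metis
  have "finite {u. v \<rightarrow>\<^bsub>G\<^esub> u}"
    by (rule finite_subset[OF _ finite_verts]) (use star in auto)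
  then have "card {u. v \<rightarrow>\<^bsub>G\<^esub> u} \<ge> 2"
    using card irrefl unfolding star(1) by simp
  then obtain S where "S \<subseteq> {u. v \<rightarrow>\<^bsub>G\<^esub> u}" "card S = 2" by (rule obtain_subset_with_card_n)
  then obtain p q where pq: "v \<rightarrow>\<^bsub>G\<^esub> p" "v \<rightarrow>\<^bsub>G\<^esub> q" "p \<noteq> q"
    unfolding card_2_iff by blast
  define c where "c = (\<lambda>u. if u = v then a else if u = p then i else b)"
  have vals: "c v = a" "c p = i" "c q = b" using pq irrefl unfolding c_def by auto
  have proper: "proper_coloring G c"
    unfolding proper_coloring_def
  proof (intro ballI impI)
    fix x y assume "x \<in> verts G" "y \<in> verts G" "x \<rightarrow>\<^bsub>G\<^esub> y"
    then have "(x = v) \<noteq> (y = v)" using star irrefl by blast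
    then show "c x \<noteq> c y" using dist unfolding c_def by auto
  qed
  have near: "within_two G x y" if "x \<in> verts G" "y \<in> verts G" for x y
    using that star sym unfolding within_two_def by auto
  have "\<exists>y. within_two G x y \<and> c y = j" if "x \<in> verts G" "j \<in> {a, b, i}" for x j
  proof -
    have "v \<in> verts G" "p \<in> verts G" "q \<in> verts G" using pq star(1) by auto
    then show ?thesis using near that vals by blast
  qed
  then have no_bad: "bad_verts G {a, b, i} c = {}"
    unfolding bad_verts_def by blast
  have "c ` verts G \<subseteq> {a, b, i}" unfolding c_def by auto
  then show ?thesis using distance_fall_coloringI[OF proper _ no_bad] by blast
qed

theorem theorem1:
  fixes G :: "('a, 'b) pre_digraph"
  assumes "graph G"
    and "Digraph_Component.connected G"
    and "card (verts G) \<ge> 3"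
    and "colorable G 3"
  shows "\<exists>c :: 'a \<Rightarrow> nat. distance_fall_coloring G 2 {1, 2, 3} c"
proof -
  interpret graph G by fact
  let ?C = "{1, 2, 3 :: nat}"
  let ?P = "\<lambda>c. proper_coloring G c \<and> c ` verts G \<subseteq> ?C"
  obtain d where "?P d" using colorable_palette[OF assms(4), of ?C] by auto
  then obtain c where c: "?P c"
    and least: "\<And>d. ?P d \<Longrightarrow> card (bad_verts G ?C c) \<le> card (bad_verts G ?C d)"
    using ex_has_least_nat[of ?P d "\<lambda>c. card (bad_verts G ?C c)"] by metis
  show ?thesis
  proof (cases "bad_verts G ?C c = {}")
    case True
    then show ?thesis using c by (intro exI[of _ c] distance_fall_coloringI) auto
  next
    case False
    then obtain v i where v: "v \<in> verts G" and i: "i \<in> ?C"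
      and miss: "\<And>w. within_two G v w \<Longrightarrow> c w \<noteq> i"
      unfolding bad_verts_def by blast
    have "c v \<noteq> i" using miss v unfolding within_two_def by blast
    moreover have "c v \<in> ?C" using c v by blast
    ultimately obtain b where b: "?C = {c v, b, i}" "c v \<noteq> b" "c v \<noteq> i" "b \<noteq> i"
    proof -
      \<comment> \<open>The colors 1, 2, 3 sum to 6, so this is the third color; the subtraction on
        naturals never truncates.\<close>
      have "6 - c v - i \<noteq> c v \<and> 6 - c v - i \<noteq> i \<and> ?C = {c v, 6 - c v - i, i}"
        using \<open>c v \<noteq> i\<close> \<open>c v \<in> ?C\<close> i by auto
      then show thesis using that[of "6 - c v - i"] \<open>c v \<noteq> i\<close> by metis
    qed
    \<comment> \<open>Otherwise recoloring \<open>v\<close> would give fewer bad vertices than the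
      minimum.\<close>
    have star: "x = v" if "v \<rightarrow>\<^bsub>G\<^esub> u" "u \<rightarrow>\<^bsub>G\<^esub> x" for u x
    proof (rule ccontr)
      assume "x \<noteq> v"
      have "c ` verts G \<subseteq> {c v, b, i}" using c unfolding b(1) by blast
      note recolor =
        bad_verts_recolor[OF conjunct1[OF c] this b(2-4) v refl miss that \<open>x \<noteq> v\<close>]
      have recolored: "?P (c(v := i))"
        using recolor(1) c i unfolding b(1) by (auto split: if_splits)
      have "bad_verts G ?C (c(v := i)) \<subset> bad_verts G ?C c"
        using recolor(2) c unfolding b(1) by blast
      moreover have "finite (bad_verts G ?C c)"
        unfolding bad_verts_def by simp
      ultimately have "card (bad_verts G ?C (c(v := i))) < card (bad_verts G ?C c)"
        by (intro psubset_card_mono)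
      with least[OF recolored] show False by linarith
    qed
    \<comment> \<open>No arc leaves the set of \<open>v\<close> and its neighbors, so by
      connectedness it is the whole graph.\<close>
    have verts: "insert v {u. v \<rightarrow>\<^bsub>G\<^esub> u} = verts G"
      by (rule connected_closed_eq_verts[OF assms(2), of v])
        (use v star in \<open>auto dest: adj_in_verts\<close>)
    show ?thesis
      unfolding b(1) by (rule star_distance_fall_coloring[OF verts[symmetric] star assms(3) b(2-4)])
  qed
qed

end
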